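(* Let $G$ be any composite graph formed from $n$ disjoint connected undirected graphs $G_i=(V_i,E_i)$, $i=1,\dots,n$, with $|V_i|=m$ for all $i$, with any choice of bridge nodes $l_i\in V_i$ and any connected backbone graph $B$ on $V_B=\{l_1,\dots,l_n\}$, and let $N=nm$ be the number of nodes of $G$. Then $$H_C(G)\ \le\ \frac{nm(m^2-1)}{12N}+\frac{nm^2(n^2-1)}{12N}+\frac{nm^2(m-1)(n-1)}{4N}.$$
   Context: Composite graph: given disjoint connected undirected graphs $G_i=(V_i,E_i)$, $i=1,\dots,n$, one node $l_i\in V_i$ (the bridge node of $G_i$) is chosen in each. The backbone graph $B=(V_B,E_B)$ is a connected undirected graph on $V_B=\{l_1,\dots,l_n\}$. The composite graph is $G=(V,E)$ with $V=V_1\cup\dots\cup V_n$ and $E=E_1\cup\dots\cup E_n\cup E_B$. Coherence: for a connected graph $G$ with $N$ nodes and (unweighted) Laplacian $L$, consider the noisy consensus dynamics $\dot x=-Lx+\nu$, with $\nu$ a zero-mean, unit-variance white noise. The network coherence is $H_C(G)=\lim_{t\to\infty}\sum_{j=1}^N\mathrm{var}\big(x_j-\frac1N\sum_{k=1}^Nx_k\big)$, which equals $\frac12\mathrm{tr}(L^\dagger)$, where $L^\dagger$ is the Moore–Penrose pseudo-inverse of $L$ (this known equality may be taken as the definition). *)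

theory Defs
  imports
    Complex_Main
    "HOL-Library.Disjoint_Sets"
    "Graph_Theory.Pair_Digraph"
    "Graph_Theory.Digraph_Component"
begin

text \<open>
  A finite simple undirected graph is a \<^locale>\<open>pair_graph\<close>: a finite loop-free digraph whose
  arcs are ordered pairs and whose arc relation is symmetric, so that the undirected edge
  \<open>{u, v}\<close> is represented by the two arcs \<open>(u, v)\<close> and \<open>(v, u)\<close>.
  Note that \<^const>\<open>Digraph_Component.connected\<close> excludes the graph without vertices.
\<close>

definition composite_graph ::
    "nat \<Rightarrow> (nat \<Rightarrow> 'a pair_pre_digraph) \<Rightarrow> 'a pair_pre_digraph \<Rightarrow> 'a pair_pre_digraph" where
  "composite_graph n G B =
     \<lparr>pverts = (\<Union>i\<in>{1..n}. pverts (G i)),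
      parcs = (\<Union>i\<in>{1..n}. parcs (G i)) \<union> parcs B\<rparr>"

text \<open>
  A real matrix whose rows and columns are indexed by a finite vertex set \<open>V\<close> is a function
  \<open>A :: 'a \<Rightarrow> 'a \<Rightarrow> real\<close> of which only the entries on \<open>V \<times> V\<close> matter.
\<close>

definition laplacian_on :: "'a pair_pre_digraph \<Rightarrow> 'a \<Rightarrow> 'a \<Rightarrow> real" where
  "laplacian_on G u v =
     (if u = v then real (out_degree (with_proj G) u)
      else if (u, v) \<in> parcs G then - 1 else 0)"

definition mat_prod_on ::
    "'a set \<Rightarrow> ('a \<Rightarrow> 'a \<Rightarrow> real) \<Rightarrow> ('a \<Rightarrow> 'a \<Rightarrow> real) \<Rightarrow> 'a \<Rightarrow> 'a \<Rightarrow> real" where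
  "mat_prod_on V A C u v = (\<Sum>w\<in>V. A u w * C w v)"

definition mat_trace_on :: "'a set \<Rightarrow> ('a \<Rightarrow> 'a \<Rightarrow> real) \<Rightarrow> real" where
  "mat_trace_on V A = (\<Sum>u\<in>V. A u u)"

text \<open>
  The four Penrose equations \<open>AXA = A\<close>, \<open>XAX = X\<close>, \<open>(AX)\<^sup>T = AX\<close>, \<open>(XA)\<^sup>T = XA\<close> on \<open>V \<times> V\<close>.
  They determine \<open>X\<close> uniquely on \<open>V \<times> V\<close>; the first conjunct fixes its value elsewhere, so that
  \<open>X\<close> is unique as a function.
\<close>

definition is_pseudo_inverse_on ::
    "'a set \<Rightarrow> ('a \<Rightarrow> 'a \<Rightarrow> real) \<Rightarrow> ('a \<Rightarrow> 'a \<Rightarrow> real) \<Rightarrow> bool" where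
  "is_pseudo_inverse_on V A X \<longleftrightarrow>
     (\<forall>u v. u \<notin> V \<or> v \<notin> V \<longrightarrow> X u v = 0) \<and>
     (\<forall>u\<in>V. \<forall>v\<in>V.
        mat_prod_on V (mat_prod_on V A X) A u v = A u v \<and>
        mat_prod_on V (mat_prod_on V X A) X u v = X u v \<and>
        mat_prod_on V A X v u = mat_prod_on V A X u v \<and>
        mat_prod_on V X A v u = mat_prod_on V X A u v)"

definition pseudo_inverse_on :: "'a set \<Rightarrow> ('a \<Rightarrow> 'a \<Rightarrow> real) \<Rightarrow> 'a \<Rightarrow> 'a \<Rightarrow> real" where
  "pseudo_inverse_on V A = (THE X. is_pseudo_inverse_on V A X)"

text \<open>
  For the dynamics \<open>x' = - L x + \<nu>\<close> with unit-variance white noise \<open>\<nu>\<close>, the steady-state total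
  variance of the deviation from the average is \<open>tr (L\<^sup>\<dagger>) / 2\<close>; this value is taken as the
  definition of the coherence.
\<close>

definition network_coherence :: "'a pair_pre_digraph \<Rightarrow> real" where
  "network_coherence G =
     mat_trace_on (pverts G) (pseudo_inverse_on (pverts G) (laplacian_on G)) / 2"

end

theory Submission
  imports Defs
begin

text \<open>
  Write \<open>X\<close> for the pseudo-inverse of the Laplacian \<open>L\<close> of a connected graph with \<open>N\<close> vertices and
  \<open>r u v = X u u + X v v - X u v - X v u\<close> for the effective resistance. The rows and columns of
  \<open>X\<close> sum to zero, so summing \<open>r\<close> over all ordered pairs of vertices gives \<open>2 N tr X\<close>, and the
  coherence is that sum divided by \<open>4 N\<close>
  (\<open>network_coherence_eq_resistance_sum\<close>). It remains to bound sums of resistances.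

  The resistance is a pseudometric that is at most \<open>1\<close> on arcs. Both facts concern the potential
  \<open>f = X (e\<^sub>u - e\<^sub>v)\<close>, which solves \<open>L f = e\<^sub>u - e\<^sub>v\<close> and satisfies \<open>r u v = f u - f v\<close>.
  Summing \<open>L f\<close> over a vertex set \<open>S\<close> gives the current that flows out of \<open>S\<close>
  (\<open>potential_cut\<close>). For a superlevel set of \<open>f\<close> all currents across the boundary flow
  outwards and their total is at most \<open>1\<close>, so no arc carries more than \<open>1\<close>
  (\<open>resistance_arc_le_1\<close>). For a sublevel set below \<open>f v\<close> they would all flow inwards
  although nothing is absorbed there, so \<open>f\<close> attains its minimum at \<open>v\<close> (\<open>potential_min\<close>),
  which is the triangle inequality in disguise.

  For any such pseudometric, growing a connected graph one vertex at a time shows that the path is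
  the worst case: the distances from one of \<open>m\<close> vertices sum to at most \<open>m (m - 1) / 2\<close>, and
  those of all ordered pairs to at most \<open>m (m\<^sup>2 - 1) / 3\<close> (\<open>pseudometric_sums_le\<close>).
  In the composite graph this applies to each part and to the backbone, always with the resistance
  of the composite graph, because their arcs are arcs of the composite graph. A pair of vertices
  in different parts is compared with the detour through the two bridge nodes:
  \<open>r u v \<le> r u (l i) + r (l i) (l j) + r (l j) v\<close>. The three terms of the bound
  come from the pairs inside a part, from the backbone leg, and from the two legs inside the parts.
\<close>

section \<open>Matrices indexed by a finite set\<close>

definition mat_vec_on :: "'a set \<Rightarrow> ('a \<Rightarrow> 'a \<Rightarrow> real) \<Rightarrow> ('a \<Rightarrow> real) \<Rightarrow> 'a \<Rightarrow> real" where
  "mat_vec_on V A x u = (\<Sum>w\<in>V. A u w * x w)"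

lemma mat_prod_on_assoc:
  "mat_prod_on V (mat_prod_on V A B) C = mat_prod_on V A (mat_prod_on V B C)"
proof (intro ext)
  fix u v
  have "mat_prod_on V (mat_prod_on V A B) C u v = (\<Sum>w\<in>V. \<Sum>x\<in>V. A u x * B x w * C w v)"
    by (simp add: mat_prod_on_def sum_distrib_right)
  also have "\<dots> = (\<Sum>x\<in>V. \<Sum>w\<in>V. A u x * B x w * C w v)"
    by (rule sum.swap)
  also have "\<dots> = mat_prod_on V A (mat_prod_on V B C) u v"
    by (simp add: mat_prod_on_def sum_distrib_left mult.assoc)
  finally show "mat_prod_on V (mat_prod_on V A B) C u v = mat_prod_on V A (mat_prod_on V B C) u v" .
qed

lemma mat_prod_on_cong:
  assumes "\<And>w. w \<in> V \<Longrightarrow> A u w = A' u w" and "\<And>w. w \<in> V \<Longrightarrow> B w v = B' w v"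
  shows "mat_prod_on V A B u v = mat_prod_on V A' B' u v"
  unfolding mat_prod_on_def using assms by (intro sum.cong) auto

text \<open>
  \<open>A X\<close> and \<open>A Y\<close> are the orthogonal projection onto the range of \<open>A\<close>: from
  \<open>A X = (A Y) (A X)\<close>, where \<open>A X\<close> and \<open>A Y\<close> are symmetric, transposing gives \<open>A X = (A X) (A Y)\<close>, and
  this is \<open>(A X A) Y = A Y\<close>. The other side is dual.
\<close>

lemma mat_prod_on_pseudo_inverse_eq:
  assumes X: "is_pseudo_inverse_on V A X" and Y: "is_pseudo_inverse_on V A Y"
    and "u \<in> V" "v \<in> V"
  shows "mat_prod_on V A X u v = mat_prod_on V A Y u v"
    and "mat_prod_on V X A u v = mat_prod_on V Y A u v"
proof -
  let ?M = "mat_prod_on V"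
  have AXA: "?M (?M A Z) A u v = A u v" and AZ: "?M A Z v u = ?M A Z u v"
    and ZA: "?M Z A v u = ?M Z A u v"
    if "is_pseudo_inverse_on V A Z" "u \<in> V" "v \<in> V" for Z u v
    using that by (auto simp: is_pseudo_inverse_on_def)
  have split_right: "?M A Z u v = ?M (?M A W) (?M A Z) u v"
    if "is_pseudo_inverse_on V A W" "u \<in> V" "v \<in> V" for Z W u v
  proof -
    have "?M A Z u v = ?M (?M (?M A W) A) Z u v"
      by (rule mat_prod_on_cong) (use AXA that in auto)
    then show ?thesis by (simp add: mat_prod_on_assoc)
  qed
  have split_left: "?M Z A u v = ?M (?M Z A) (?M W A) u v"
    if "is_pseudo_inverse_on V A W" "u \<in> V" "v \<in> V" for Z W u v
  proof -
    have "?M Z A u v = ?M Z (?M (?M A W) A) u v"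
      by (rule mat_prod_on_cong) (use AXA that in auto)
    then show ?thesis by (simp add: mat_prod_on_assoc)
  qed
  have "?M A X u v = ?M A X v u" using AZ X assms by simp
  also have "\<dots> = ?M (?M A Y) (?M A X) v u" using split_right Y assms by blast
  also have "\<dots> = ?M (?M A X) (?M A Y) u v"
    unfolding mat_prod_on_def[of V "?M A X"] mat_prod_on_def[of V "?M A Y"]
    using AZ[OF X] AZ[OF Y] assms by (intro sum.cong) auto
  also have "\<dots> = ?M A Y u v" using split_right[OF X, of u v Y] assms by simp
  finally show "?M A X u v = ?M A Y u v" .
  have "?M X A u v = ?M (?M X A) (?M Y A) u v" using split_left Y assms by blast
  also have "\<dots> = ?M (?M Y A) (?M X A) v u"
    unfolding mat_prod_on_def[of V "?M X A"] mat_prod_on_def[of V "?M Y A"]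
    using ZA[OF X] ZA[OF Y] assms by (intro sum.cong) auto
  also have "\<dots> = ?M Y A v u" using split_left[OF X, of v u Y] assms by simp
  also have "\<dots> = ?M Y A u v" using ZA Y assms by simp
  finally show "?M X A u v = ?M Y A u v" .
qed

lemma pseudo_inverse_on_unique:
  assumes X: "is_pseudo_inverse_on V A X" and Y: "is_pseudo_inverse_on V A Y"
  shows "X = Y"
proof (intro ext)
  fix u v
  let ?M = "mat_prod_on V"
  show "X u v = Y u v"
  proof (cases "u \<in> V \<and> v \<in> V")
    case True
    note eq = mat_prod_on_pseudo_inverse_eq[OF X Y]
    have "X u v = ?M (?M X A) X u v" using X True by (auto simp: is_pseudo_inverse_on_def)
    also have "\<dots> = ?M (?M Y A) X u v" by (rule mat_prod_on_cong) (use eq True in auto)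
    also have "\<dots> = ?M Y (?M A X) u v" by (simp add: mat_prod_on_assoc)
    also have "\<dots> = ?M Y (?M A Y) u v" by (rule mat_prod_on_cong) (use eq True in auto)
    also have "\<dots> = ?M (?M Y A) Y u v" by (simp add: mat_prod_on_assoc)
    also have "\<dots> = Y u v" using Y True by (auto simp: is_pseudo_inverse_on_def)
    finally show ?thesis .
  qed (use X Y in \<open>auto simp: is_pseudo_inverse_on_def\<close>)
qed

lemma pseudo_inverse_on_eqI:
  "is_pseudo_inverse_on V A X \<Longrightarrow> pseudo_inverse_on V A = X"
  unfolding pseudo_inverse_on_def using pseudo_inverse_on_unique by blast

text \<open>
  Gaussian elimination never needs to exchange rows here: the pivot \<open>A a a\<close> is the value of the
  form at a unit vector, and eliminating \<open>a\<close> leaves the Schur complement, whose form at \<open>x\<close> is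
  that of \<open>A\<close> at a suitable extension of \<open>x\<close> to \<open>a\<close>, hence again positive.
\<close>

lemma positive_definite_solvable:
  assumes "finite V"
    and "\<And>x. \<exists>v\<in>V. x v \<noteq> 0 \<Longrightarrow> (\<Sum>u\<in>V. x u * mat_vec_on V A x u) > 0"
  shows "\<exists>x. \<forall>u\<in>V. mat_vec_on V A x u = b u"
  using assms
proof (induction V arbitrary: A b)
  case empty
  then show ?case by simp
next
  case (insert a V)
  have vec_insert: "mat_vec_on (insert a V) A x u = A u a * x a + mat_vec_on V A x u" for x u
    using insert.hyps by (simp add: mat_vec_on_def)
  have vec_cong: "mat_vec_on V A (x(a := c)) u = mat_vec_on V A x u" for x c u
    unfolding mat_vec_on_def using insert.hyps by (intro sum.cong) auto
  have pivot: "A a a > 0"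
  proof -
    have "mat_vec_on V A (\<lambda>u. of_bool (u = a)) a = 0"
      unfolding mat_vec_on_def using insert.hyps by (intro sum.neutral) auto
    moreover have "(\<Sum>u\<in>V. of_bool (u = a) * mat_vec_on (insert a V) A (\<lambda>u. of_bool (u = a)) u) = 0"
      using insert.hyps by (intro sum.neutral) auto
    ultimately show ?thesis
      using insert.prems[of "\<lambda>u. of_bool (u = a)"] insert.hyps by (simp add: vec_insert)
  qed
  \<comment> \<open>the Schur complement of the entry \<open>A a a\<close>\<close>
  define C where "C u w = A u w - A u a * A a w / A a a" for u w
  have C_vec: "mat_vec_on V C x u = mat_vec_on V A x u - A u a * mat_vec_on V A x a / A a a" for x u
    by (simp add: mat_vec_on_def C_def algebra_simps sum_subtractf sum_distrib_left
        sum_divide_distrib)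
  have "(\<Sum>u\<in>V. x u * mat_vec_on V C x u) > 0" if x: "\<exists>v\<in>V. x v \<noteq> 0" for x
  proof -
    \<comment> \<open>The value at \<open>a\<close> is chosen such that the row \<open>a\<close> of \<open>A\<close> annihilates \<open>y\<close>.\<close>
    define y where "y = x(a := - mat_vec_on V A x a / A a a)"
    have "\<exists>v\<in>insert a V. y v \<noteq> 0" using x insert.hyps by (auto simp: y_def)
    then have "0 < (\<Sum>u\<in>insert a V. y u * mat_vec_on (insert a V) A y u)" by (rule insert.prems)
    also have "\<dots> = (\<Sum>u\<in>V. y u * mat_vec_on (insert a V) A y u)"
      using insert.hyps pivot by (simp add: vec_insert y_def vec_cong)
    also have "\<dots> = (\<Sum>u\<in>V. x u * mat_vec_on V C x u)"
      using insert.hyps by (intro sum.cong) (auto simp: vec_insert y_def vec_cong C_vec)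
    finally show ?thesis .
  qed
  then obtain x where x: "\<forall>u\<in>V. mat_vec_on V C x u = b u - A u a * b a / A a a"
    using insert.IH[of C "\<lambda>u. b u - A u a * b a / A a a"] by auto
  define y where "y = x(a := (b a - mat_vec_on V A x a) / A a a)"
  have "mat_vec_on (insert a V) A y u = b u" if "u \<in> insert a V" for u
    using that x pivot insert.hyps
    by (auto simp: vec_insert y_def vec_cong C_vec field_simps)
  then show ?case by blast
qed

section \<open>The Laplacian and its potentials\<close>

text \<open>
  Connectedness is used only through closed vertex sets. This form suits level sets of
  functions, and it passes easily from the parts and the backbone to a composite graph.
\<close>

locale cut_connected_graph = pair_graph G for G :: "'a pair_pre_digraph" +
  assumes nonempty: "pverts G \<noteq> {}"
    and closed_eq_verts:
      "\<lbrakk>S \<subseteq> pverts G; S \<noteq> {}; \<And>u v. (u, v) \<in> parcs G \<Longrightarrow> u \<in> S \<Longrightarrow> v \<in> S\<rbrakk> \<Longrightarrow> S = pverts G"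

lemma cut_connected_graph_if_connected:
  assumes "pair_graph G" and "Digraph_Component.connected (with_proj G)"
  shows "cut_connected_graph G"
proof -
  interpret pair_graph G by fact
  have conn: "pverts G \<noteq> {}"
    "\<And>u v. u \<in> pverts G \<Longrightarrow> v \<in> pverts G \<Longrightarrow> (u, v) \<in> rtrancl_on (pverts G) ((parcs G)\<^sup>s)"
    using assms(2) unfolding connected_conv by auto
  show ?thesis
  proof
    fix S
    assume S: "S \<subseteq> pverts G" "S \<noteq> {}"
      and closed: "\<And>u v. (u, v) \<in> parcs G \<Longrightarrow> u \<in> S \<Longrightarrow> v \<in> S"
    obtain a where a: "a \<in> S" using S by blast
    have "v \<in> S" if "v \<in> pverts G" for v
    proof -
      have "(a, v) \<in> rtrancl_on (pverts G) ((parcs G)\<^sup>s)" using conn a S that by blast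
      then show ?thesis
      proof (induction rule: rtrancl_on_induct)
        case base
        then show ?case using a by simp
      next
        case (step y z)
        then have "(y, z) \<in> parcs G"
          using arcs_symmetric by (auto simp: symcl_def)
        then show ?case using closed step by blast
      qed
    qed
    then show "S = pverts G" using S by blast
  qed (rule conn)
qed

context cut_connected_graph
begin

abbreviation order :: real where "order \<equiv> real (card (pverts G))"

lemma order_pos: "order > 0"
  using nonempty pair_finite_verts by (simp add: card_gt_0_iff)

lemma arc_commute: "(u, v) \<in> parcs G \<longleftrightarrow> (v, u) \<in> parcs G"
  using arcs_symmetric by blast

lemma laplacian_sym: "laplacian_on G u v = laplacian_on G v u"
  using arc_commute by (simp add: laplacian_on_def)

definition adjacency :: "'a \<Rightarrow> 'a \<Rightarrow> real" where
  "adjacency u v = of_bool ((u, v) \<in> parcs G)"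

lemma adjacency_commute: "adjacency u v = adjacency v u"
  by (simp add: adjacency_def arc_commute)

lemma adjacency_arc: "(u, v) \<in> parcs G \<Longrightarrow> adjacency u v = 1"
  by (simp add: adjacency_def)

lemma adjacency_nonneg: "adjacency u v \<ge> 0"
  by (simp add: adjacency_def)

lemma laplacian_vec:
  assumes "u \<in> pverts G"
  shows "mat_vec_on (pverts G) (laplacian_on G) x u
    = (\<Sum>w\<in>pverts G. adjacency u w * (x u - x w))"
proof -
  have "out_arcs (with_proj G) u = Pair u ` {w \<in> pverts G. (u, w) \<in> parcs G}"
    using arc_snd_in_verts by (force simp: out_arcs_def)
  then have "real (out_degree (with_proj G) u) = (\<Sum>w\<in>pverts G. adjacency u w)"
    using pair_finite_verts
    by (simp add: out_degree_def card_image inj_on_def adjacency_def Int_def)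
  moreover have "laplacian_on G u w
      = (if u = w then real (out_degree (with_proj G) u) else 0) - adjacency u w" for w
    using pair_no_loops by (force simp: laplacian_on_def adjacency_def)
  ultimately show ?thesis
    using assms pair_finite_verts
    by (simp add: mat_vec_on_def left_diff_distrib right_diff_distrib sum_subtractf
        if_distrib[of "\<lambda>c. c * _"] flip: sum_distrib_right cong: if_cong)
qed

text \<open>
  The Dirichlet energy; the factor \<open>1 / 2\<close> is there because each undirected edge gives two arcs.
\<close>

lemma laplacian_form:
  "(\<Sum>u\<in>pverts G. x u * mat_vec_on (pverts G) (laplacian_on G) x u)
    = (\<Sum>u\<in>pverts G. \<Sum>w\<in>pverts G. adjacency u w * (x u - x w)\<^sup>2) / 2"
proof -
  let ?V = "pverts G"
  have "(\<Sum>u\<in>?V. \<Sum>w\<in>?V. adjacency u w * (x w * (x w - x u))) = (\<Sum>u\<in>?V. \<Sum>w\<in>?V. adjacency w u * (x u * (x u - x w)))"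
    by (subst sum.swap) (rule refl)
  then have swap: "(\<Sum>u\<in>?V. \<Sum>w\<in>?V. adjacency u w * (x w * (x w - x u)))
      = (\<Sum>u\<in>?V. \<Sum>w\<in>?V. adjacency u w * (x u * (x u - x w)))"
    by (simp add: adjacency_commute)
  have "(\<Sum>u\<in>?V. \<Sum>w\<in>?V. adjacency u w * (x u - x w)\<^sup>2)
      = (\<Sum>u\<in>?V. \<Sum>w\<in>?V. adjacency u w * (x u * (x u - x w)) + adjacency u w * (x w * (x w - x u)))"
    by (simp add: power2_eq_square algebra_simps)
  also have "\<dots> = 2 * (\<Sum>u\<in>?V. \<Sum>w\<in>?V. adjacency u w * (x u * (x u - x w)))"
    by (simp add: sum.distrib swap)
  also have "\<dots> = 2 * (\<Sum>u\<in>?V. x u * mat_vec_on ?V (laplacian_on G) x u)"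
    by (simp add: laplacian_vec sum_distrib_left mult.left_commute)
  finally show ?thesis by simp
qed

text \<open>
  The currents along arcs inside \<open>S\<close> cancel in pairs, so that only the flow from \<open>S\<close> to its
  complement remains.
\<close>

lemma laplacian_cut:
  assumes "S \<subseteq> pverts G"
  shows "(\<Sum>z\<in>S. mat_vec_on (pverts G) (laplacian_on G) x z)
    = (\<Sum>z\<in>S. \<Sum>w\<in>pverts G - S. adjacency z w * (x z - x w))"
proof -
  let ?f = "\<lambda>z w. adjacency z w * (x z - x w)"
  have "(\<Sum>z\<in>S. \<Sum>w\<in>S. ?f z w) = (\<Sum>z\<in>S. \<Sum>w\<in>S. ?f w z)"
    by (rule sum.swap)
  also have "\<dots> = - (\<Sum>z\<in>S. \<Sum>w\<in>S. ?f z w)"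
    unfolding sum_negf[symmetric]
    by (intro sum.cong refl) (metis adjacency_commute minus_diff_eq mult_minus_right)
  finally have inner: "(\<Sum>z\<in>S. \<Sum>w\<in>S. ?f z w) = 0" by simp
  have "(\<Sum>z\<in>S. mat_vec_on (pverts G) (laplacian_on G) x z) = (\<Sum>z\<in>S. \<Sum>w\<in>pverts G. ?f z w)"
    using assms by (intro sum.cong) (auto simp: laplacian_vec)
  also have "\<dots> = (\<Sum>z\<in>S. (\<Sum>w\<in>pverts G - S. ?f z w) + (\<Sum>w\<in>S. ?f z w))"
    using sum.subset_diff[OF assms pair_finite_verts] by (intro sum.cong refl) blast
  also have "\<dots> = (\<Sum>z\<in>S. \<Sum>w\<in>pverts G - S. ?f z w)"
    by (simp add: sum.distrib inner)
  finally show ?thesis .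
qed

lemma laplacian_vec_sum: "(\<Sum>u\<in>pverts G. mat_vec_on (pverts G) (laplacian_on G) x u) = 0"
  by (simp add: laplacian_cut)

text \<open>
  Adding the all-ones matrix adds the square of \<open>\<Sum>x\<close> to the Dirichlet energy. If both vanish,
  then \<open>x\<close> is constant by connectedness and has sum zero, so it is zero.
\<close>

lemma laplacian_definite:
  assumes "\<exists>v\<in>pverts G. x v \<noteq> 0"
  shows "(\<Sum>u\<in>pverts G. x u * mat_vec_on (pverts G) (\<lambda>u w. laplacian_on G u w + 1) x u) > 0"
proof -
  let ?V = "pverts G"
  let ?E = "\<Sum>u\<in>?V. \<Sum>w\<in>?V. adjacency u w * (x u - x w)\<^sup>2"
  have E: "?E \<ge> 0" by (intro sum_nonneg) (simp add: adjacency_nonneg)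
  have vec: "mat_vec_on ?V (\<lambda>u w. laplacian_on G u w + 1) x u
      = mat_vec_on ?V (laplacian_on G) x u + sum x ?V" for u
    by (simp add: mat_vec_on_def algebra_simps sum.distrib)
  have form: "(\<Sum>u\<in>?V. x u * mat_vec_on ?V (\<lambda>u w. laplacian_on G u w + 1) x u)
      = ?E / 2 + (sum x ?V)\<^sup>2"
    by (simp add: vec distrib_left sum.distrib laplacian_form power2_eq_square
        flip: sum_distrib_right)
  have "?E \<noteq> 0 \<or> sum x ?V \<noteq> 0"
  proof (rule ccontr)
    assume "\<not> ?thesis"
    then have zero: "?E = 0" "sum x ?V = 0" by auto
    have eq: "x u = x w" if "(u, w) \<in> parcs G" for u w
    proof -
      have uw: "u \<in> ?V" "w \<in> ?V" using that arc_fst_in_verts arc_snd_in_verts by force+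
      have "\<forall>u\<in>?V. (\<Sum>w\<in>?V. adjacency u w * (x u - x w)\<^sup>2) = 0"
        using zero(1) pair_finite_verts by (subst (asm) sum_nonneg_eq_0_iff) (auto simp: adjacency_nonneg intro: sum_nonneg)
      then have "\<forall>w\<in>?V. adjacency u w * (x u - x w)\<^sup>2 = 0"
        using uw pair_finite_verts by (subst (asm) sum_nonneg_eq_0_iff) (auto simp: adjacency_nonneg)
      then show ?thesis using uw that by (auto simp: adjacency_arc)
    qed
    obtain v where v: "v \<in> ?V" "x v \<noteq> 0" using assms by blast
    have "{u \<in> ?V. x u = x v} = ?V"
      by (rule closed_eq_verts) (use v eq arc_snd_in_verts in force)+
    then have "sum x ?V = (\<Sum>u\<in>?V. x v)" by (intro sum.cong) auto
    then show False using zero v order_pos by simp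
  qed
  then show ?thesis using E unfolding form by (smt (verit) zero_less_power2 zero_le_power2 field_sum_of_halves)
qed

text \<open>
  Solve the equation for the definite matrix \<open>L\<close> plus all-ones instead. Summing over all
  vertices removes both \<open>L\<close> and the right-hand side, so the solution has sum zero and the added
  all-ones matrix does not act on it.
\<close>

lemma ex_green_function:
  assumes "v \<in> pverts G"
  shows "\<exists>g. (\<forall>u\<in>pverts G. mat_vec_on (pverts G) (laplacian_on G) g u
      = of_bool (u = v) - 1 / order) \<and> (\<Sum>u\<in>pverts G. g u) = 0"
proof -
  let ?V = "pverts G"
  obtain g where g: "\<forall>u\<in>?V. mat_vec_on ?V (\<lambda>u w. laplacian_on G u w + 1) g u
      = of_bool (u = v) - 1 / order"
    using positive_definite_solvable[OF pair_finite_verts laplacian_definite,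
        of "\<lambda>u. of_bool (u = v) - 1 / order"] by auto
  have vec: "mat_vec_on ?V (\<lambda>u w. laplacian_on G u w + 1) g u
      = mat_vec_on ?V (laplacian_on G) g u + sum g ?V" for u
    by (simp add: mat_vec_on_def algebra_simps sum.distrib)
  have "(\<Sum>u\<in>?V. mat_vec_on ?V (laplacian_on G) g u + sum g ?V)
      = (\<Sum>u\<in>?V. of_bool (u = v) - 1 / order)"
    using g by (intro sum.cong) (auto simp: vec)
  then have "order * sum g ?V = 0"
    using assms order_pos pair_finite_verts nonempty by (simp add: sum.distrib laplacian_vec_sum sum_subtractf)
  then have "sum g ?V = 0" using order_pos nonempty by auto
  then show ?thesis using g vec by (intro exI[of _ g]) simp
qed

abbreviation pinv :: "'a \<Rightarrow> 'a \<Rightarrow> real" where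
  "pinv \<equiv> pseudo_inverse_on (pverts G) (laplacian_on G)"

text \<open>
  The matrix \<open>X\<close> whose columns are the Green functions satisfies \<open>L X = I - J / N\<close>, where \<open>J\<close>
  is the all-ones matrix, and its columns sum to zero. Hence \<open>X\<^sup>T = X\<^sup>T (L X)\<close>; the product
  \<open>X\<^sup>T L X\<close> is symmetric, so \<open>X\<close> is, and then \<open>X L = L X\<close>. Multiplication from the left by
  \<open>I - J / N\<close> fixes every matrix with zero column sums, which gives the Penrose equations.
\<close>

lemma pinv_green:
  shows pinv_vec: "\<And>u v. u \<in> pverts G \<Longrightarrow> v \<in> pverts G \<Longrightarrow>
      mat_vec_on (pverts G) (laplacian_on G) (\<lambda>w. pinv w v) u = of_bool (u = v) - 1 / order"
    and pinv_sum: "\<And>v. v \<in> pverts G \<Longrightarrow> (\<Sum>u\<in>pverts G. pinv u v) = 0"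
    and pinv_sym: "\<And>u v. u \<in> pverts G \<Longrightarrow> v \<in> pverts G \<Longrightarrow> pinv u v = pinv v u"
proof -
  let ?V = "pverts G" and ?L = "laplacian_on G" and ?M = "mat_prod_on (pverts G)"
  obtain g where g: "\<And>u v. u \<in> ?V \<Longrightarrow> v \<in> ?V \<Longrightarrow> mat_vec_on ?V ?L (g v) u = of_bool (u = v) - 1 / order"
      "\<And>v. v \<in> ?V \<Longrightarrow> (\<Sum>u\<in>?V. g v u) = 0"
    using ex_green_function by metis
  define X where "X u v = (if u \<in> ?V \<and> v \<in> ?V then g v u else 0)" for u v
  have vec: "mat_vec_on ?V ?L (\<lambda>w. X w v) u = of_bool (u = v) - 1 / order" if "u \<in> ?V" "v \<in> ?V" for u v
    using g(1)[OF that] that by (simp add: mat_vec_on_def X_def)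
  have col: "(\<Sum>u\<in>?V. X u v) = 0" if "v \<in> ?V" for v
    using g(2)[OF that] that by (simp add: X_def)
  have LX: "?M ?L X u v = of_bool (u = v) - 1 / order" if "u \<in> ?V" "v \<in> ?V" for u v
    using vec[OF that] by (simp add: mat_prod_on_def mat_vec_on_def)
  have form: "X v u = (\<Sum>w\<in>?V. X w u * (\<Sum>z\<in>?V. ?L w z * X z v))" if "u \<in> ?V" "v \<in> ?V" for u v
  proof -
    have "(\<Sum>w\<in>?V. X w u * (\<Sum>z\<in>?V. ?L w z * X z v)) = (\<Sum>w\<in>?V. X w u * (of_bool (w = v) - 1 / order))"
      using LX that by (intro sum.cong) (auto simp: mat_prod_on_def)
    also have "\<dots> = X v u"
      using that pair_finite_verts col
      by (simp add: right_diff_distrib sum_subtractf flip: sum_divide_distrib)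
    finally show ?thesis by simp
  qed
  have sym: "X v u = X u v" if "u \<in> ?V" "v \<in> ?V" for u v
  proof -
    have "X v u = (\<Sum>w\<in>?V. \<Sum>z\<in>?V. X w u * (?L w z * X z v))"
      using form[OF that] by (simp only: sum_distrib_left)
    also have "\<dots> = (\<Sum>z\<in>?V. \<Sum>w\<in>?V. X w u * (?L w z * X z v))" by (rule sum.swap)
    also have "\<dots> = (\<Sum>z\<in>?V. X z v * (\<Sum>w\<in>?V. ?L z w * X w u))"
      by (simp add: sum_distrib_left laplacian_sym ac_simps)
    also have "\<dots> = X u v" using that by (intro form[symmetric])
    finally show ?thesis .
  qed
  have XL: "?M X ?L u v = of_bool (u = v) - 1 / order" if "u \<in> ?V" "v \<in> ?V" for u v
  proof -
    have "?M X ?L u v = ?M ?L X v u"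
      unfolding mat_prod_on_def using that sym by (intro sum.cong) (auto simp: laplacian_sym)
    then show ?thesis using LX that by auto
  qed
  have colL: "(\<Sum>w\<in>?V. ?L w v) = 0" if "v \<in> ?V" for v
    using laplacian_vec_sum[of "\<lambda>w. of_bool (w = v)"] that pair_finite_verts
    by (simp add: mat_vec_on_def)
  have proj: "?M Z A u v = A u v"
    if "\<And>w. w \<in> ?V \<Longrightarrow> Z u w = of_bool (u = w) - 1 / order" "(\<Sum>w\<in>?V. A w v) = 0" "u \<in> ?V" for Z A u v
  proof -
    have "?M Z A u v = (\<Sum>w\<in>?V. (of_bool (u = w) - 1 / order) * A w v)"
      unfolding mat_prod_on_def using that(1) by (intro sum.cong) auto
    also have "\<dots> = A u v"
      using that pair_finite_verts
      by (simp add: left_diff_distrib sum_subtractf flip: sum_divide_distrib)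
    finally show ?thesis .
  qed
  have "is_pseudo_inverse_on ?V ?L X"
    unfolding is_pseudo_inverse_on_def
    using LX XL proj[of "?M ?L X" _ ?L] proj[of "?M X ?L" _ X] colL col
    by (auto simp: X_def)
  then have "pinv = X" by (rule pseudo_inverse_on_eqI)
  then show "\<And>u v. u \<in> ?V \<Longrightarrow> v \<in> ?V \<Longrightarrow>
      mat_vec_on ?V ?L (\<lambda>w. pinv w v) u = of_bool (u = v) - 1 / order"
    "\<And>v. v \<in> ?V \<Longrightarrow> (\<Sum>u\<in>?V. pinv u v) = 0"
    "\<And>u v. u \<in> ?V \<Longrightarrow> v \<in> ?V \<Longrightarrow> pinv u v = pinv v u"
    using vec col sym by simp_all
qed

section \<open>Effective resistance\<close>

definition resistance :: "'a \<Rightarrow> 'a \<Rightarrow> real" where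
  "resistance u v = pinv u u + pinv v v - pinv u v - pinv v u"

text \<open>The potential when a unit current enters at \<open>u\<close> and leaves at \<open>v\<close>.\<close>

definition potential :: "'a \<Rightarrow> 'a \<Rightarrow> 'a \<Rightarrow> real" where
  "potential u v w = pinv w u - pinv w v"

lemma potential_vec:
  assumes "u \<in> pverts G" "v \<in> pverts G" "z \<in> pverts G"
  shows "mat_vec_on (pverts G) (laplacian_on G) (potential u v) z = of_bool (z = u) - of_bool (z = v)"
proof -
  have "mat_vec_on (pverts G) (laplacian_on G) (potential u v) z
    = mat_vec_on (pverts G) (laplacian_on G) (\<lambda>w. pinv w u) z
      - mat_vec_on (pverts G) (laplacian_on G) (\<lambda>w. pinv w v) z"
    by (simp add: mat_vec_on_def potential_def right_diff_distrib sum_subtractf)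
  then show ?thesis using assms by (simp add: pinv_vec)
qed

lemma potential_cut:
  assumes "u \<in> pverts G" "v \<in> pverts G" "S \<subseteq> pverts G"
  shows "(\<Sum>z\<in>S. \<Sum>w\<in>pverts G - S. adjacency z w * (potential u v z - potential u v w))
    = of_bool (u \<in> S) - of_bool (v \<in> S)"
proof -
  have fin: "finite S" using assms(3) pair_finite_verts by (rule finite_subset)
  have "(\<Sum>z\<in>S. mat_vec_on (pverts G) (laplacian_on G) (potential u v) z)
      = (\<Sum>z\<in>S. of_bool (z = u) - of_bool (z = v))"
    using assms by (intro sum.cong) (auto simp: potential_vec)
  also have "\<dots> = of_bool (u \<in> S) - of_bool (v \<in> S)"
    using fin by (simp add: sum_subtractf)
  finally show ?thesis using laplacian_cut[OF assms(3)] by simp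
qed

text \<open>
  If the potential drops along the arc, then the arc crosses the boundary of the superlevel set
  \<open>{z. f z \<ge> f u}\<close>. Every arc leaving this set carries a nonnegative current and the
  total is the unit current from the source, so the drop along the single arc is at most \<open>1\<close>.
\<close>

lemma resistance_arc_le_1:
  assumes arc: "(u, v) \<in> parcs G"
  shows "resistance u v \<le> 1"
proof -
  let ?V = "pverts G" and ?f = "potential u v"
  have uv: "u \<in> ?V" "v \<in> ?V" using arc arc_fst_in_verts arc_snd_in_verts by force+
  have r: "resistance u v = ?f u - ?f v" by (simp add: resistance_def potential_def)
  show ?thesis
  proof (cases "?f u > ?f v")
    case True
    define S where "S = {z \<in> ?V. ?f z \<ge> ?f u}"
    let ?c = "\<lambda>z w. adjacency z w * (?f z - ?f w)"
    have S: "S \<subseteq> ?V" "u \<in> S" "v \<notin> S" using uv True by (auto simp: S_def)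
    have fin: "finite S" "finite (?V - S)" using S pair_finite_verts by (auto intro: finite_subset)
    have nonneg: "?c z w \<ge> 0" if "z \<in> S" "w \<in> ?V - S" for z w
      using that adjacency_nonneg by (auto simp: S_def intro!: mult_nonneg_nonneg)
    have "?f u - ?f v = ?c u v" using arc by (simp add: adjacency_arc)
    also have "\<dots> \<le> (\<Sum>w\<in>?V - S. ?c u w)"
      using fin S uv nonneg by (intro member_le_sum) auto
    also have "\<dots> \<le> (\<Sum>z\<in>S. \<Sum>w\<in>?V - S. ?c z w)"
      using fin S nonneg by (intro member_le_sum[of u S "\<lambda>z. \<Sum>w\<in>?V - S. ?c z w"] sum_nonneg) auto
    also have "\<dots> = 1" using potential_cut[OF uv S(1)] S by simp
    finally show ?thesis using r by simp
  qed (use r in simp)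
qed

text \<open>
  The minimum principle. The set of vertices with potential below that of the sink \<open>v\<close> contains
  no sink, so its net outflow is nonnegative; but an arc leaving it would carry a strictly negative
  current. So no arc leaves it, and by connectedness it is empty since it misses \<open>v\<close>.
\<close>

lemma potential_min:
  assumes "u \<in> pverts G" "v \<in> pverts G" "w \<in> pverts G"
  shows "potential u v v \<le> potential u v w"
proof (rule ccontr)
  let ?V = "pverts G" and ?f = "potential u v"
  assume above: "\<not> ?f v \<le> ?f w"
  define S where "S = {z \<in> ?V. ?f z < ?f v}"
  let ?c = "\<lambda>z w. adjacency z w * (?f w - ?f z)"
  have S: "S \<subseteq> ?V" "w \<in> S" "v \<notin> S" using assms above by (auto simp: S_def)
  have fin: "finite S" "finite (?V - S)" using S pair_finite_verts by (auto intro: finite_subset)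
  have nonneg: "?c z w \<ge> 0" if "z \<in> S" "w \<in> ?V - S" for z w
      using that adjacency_nonneg by (auto simp: S_def intro!: mult_nonneg_nonneg)
  have "(\<Sum>z\<in>S. \<Sum>w\<in>?V - S. ?c z w)
      = - (\<Sum>z\<in>S. \<Sum>w\<in>?V - S. adjacency z w * (?f z - ?f w))"
    unfolding sum_negf[symmetric]
    by (intro sum.cong refl) (metis minus_diff_eq mult_minus_right)
  also have "\<dots> \<le> 0" using potential_cut[OF assms(1,2) S(1)] S by simp
  finally have le: "(\<Sum>z\<in>S. \<Sum>w\<in>?V - S. ?c z w) \<le> 0" .
  have "S = ?V"
  proof (rule closed_eq_verts)
    fix z y assume arc: "(z, y) \<in> parcs G" and z: "z \<in> S"
    show "y \<in> S"
    proof (rule ccontr)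
      assume "y \<notin> S"
      then have y: "y \<in> ?V - S" using arc arc_snd_in_verts by force
      have "0 < ?c z y" using arc y z by (auto simp: S_def adjacency_arc)
      also have "\<dots> \<le> (\<Sum>w\<in>?V - S. ?c z w)"
        using fin y z nonneg by (intro member_le_sum) auto
      also have "\<dots> \<le> (\<Sum>z\<in>S. \<Sum>w\<in>?V - S. ?c z w)"
        using fin z nonneg by (intro member_le_sum[of z S "\<lambda>z. \<Sum>w\<in>?V - S. ?c z w"] sum_nonneg) auto
      finally show False using le by simp
    qed
  qed (use S in auto)
  then show False using S assms by simp
qed

lemma resistance_refl: "resistance u u = 0"
  by (simp add: resistance_def)

lemma resistance_sym: "resistance u v = resistance v u"
  by (simp add: resistance_def)

text \<open>
  By symmetry of \<open>X\<close>, the defect of the triangle inequality at \<open>v\<close> is twice the potential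
  difference between \<open>w\<close> and the sink \<open>v\<close>.
\<close>

lemma resistance_triangle:
  assumes "u \<in> pverts G" "v \<in> pverts G" "w \<in> pverts G"
  shows "resistance u w \<le> resistance u v + resistance v w"
proof -
  have "resistance u v + resistance v w - resistance u w = 2 * (potential u v w - potential u v v)"
    using pinv_sym assms by (simp add: resistance_def potential_def)
  then show ?thesis using potential_min[OF assms] by simp
qed

lemma network_coherence_eq_resistance_sum:
  "network_coherence G = (\<Sum>u\<in>pverts G. \<Sum>v\<in>pverts G. resistance u v) / (4 * order)"
proof -
  let ?V = "pverts G"
  let ?t = "\<Sum>u\<in>?V. pinv u u"
  have "(\<Sum>u\<in>?V. \<Sum>v\<in>?V. pinv v u) = 0" by (simp add: pinv_sum)
  moreover have "(\<Sum>u\<in>?V. \<Sum>v\<in>?V. pinv u v) = (\<Sum>u\<in>?V. \<Sum>v\<in>?V. pinv v u)"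
    by (rule sum.swap)
  ultimately have "(\<Sum>u\<in>?V. \<Sum>v\<in>?V. resistance u v) = 2 * order * ?t"
    by (simp add: resistance_def sum_subtractf sum.distrib flip: sum_distrib_left)
  then show ?thesis
    using order_pos by (simp add: network_coherence_def mat_trace_on_def)
qed

section \<open>Sums of distances in a connected graph\<close>

text \<open>
  Building the vertex set by repeatedly attaching a neighbour: a maximal set that can be built in
  this way has no leaving arc.
\<close>

lemma grow_induct [case_names single grow]:
  assumes single: "\<And>a. a \<in> pverts G \<Longrightarrow> P {a}"
    and grow: "\<And>S w x. \<lbrakk>S \<subseteq> pverts G; P S; w \<in> S; x \<in> pverts G; x \<notin> S; (w, x) \<in> parcs G\<rbrakk>
      \<Longrightarrow> P (insert x S)"
  shows "P (pverts G)"
proof -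
  define F where "F = {S. S \<subseteq> pverts G \<and> S \<noteq> {} \<and> P S}"
  obtain a where "a \<in> pverts G" using nonempty by blast
  then have "F \<noteq> {}" using single by (auto simp: F_def)
  moreover have "finite F" using pair_finite_verts by (simp add: F_def)
  ultimately obtain S where "S \<in> F" and max: "\<forall>T\<in>F. S \<subseteq> T \<longrightarrow> S = T"
    using finite_has_maximal by metis
  then have S: "S \<subseteq> pverts G" "S \<noteq> {}" "P S" by (auto simp: F_def)
  have "S = pverts G"
  proof (rule closed_eq_verts)
    fix w x assume wx: "(w, x) \<in> parcs G" "w \<in> S"
    then have x: "x \<in> pverts G" using arc_snd_in_verts by force
    show "x \<in> S"
    proof (rule ccontr)
      assume "x \<notin> S"
      then have "P (insert x S)" using S wx x by (intro grow[of S w x])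
      then have "insert x S \<in> F" using S x by (simp add: F_def)
      then show False using max \<open>x \<notin> S\<close> by blast
    qed
  qed (use S in auto)
  then show ?thesis using S by simp
qed

text \<open>
  Let \<open>x\<close> be attached to a set of \<open>k\<close> vertices through its neighbour \<open>w\<close>. Since
  \<open>d x u \<le> 1 + d w u\<close>, the diameter grows by at most \<open>1\<close>, the distances from \<open>x\<close> sum to at most
  \<open>k + k (k - 1) / 2 = k (k + 1) / 2\<close>, and the total over ordered pairs grows by at most twice
  that. The bound on the diameter is carried along because a distance sum from an old vertex
  gains the distance to \<open>x\<close>, which must be at most \<open>k\<close>.
\<close>

lemma pseudometric_sums_le:
  fixes d :: "'a \<Rightarrow> 'a \<Rightarrow> real"
  assumes refl: "\<And>u. u \<in> pverts G \<Longrightarrow> d u u = 0"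
    and sym: "\<And>u v. u \<in> pverts G \<Longrightarrow> v \<in> pverts G \<Longrightarrow> d u v = d v u"
    and triangle: "\<And>u v w. u \<in> pverts G \<Longrightarrow> v \<in> pverts G \<Longrightarrow> w \<in> pverts G \<Longrightarrow> d u w \<le> d u v + d v w"
    and arc: "\<And>u v. (u, v) \<in> parcs G \<Longrightarrow> d u v \<le> 1"
  shows pseudometric_sum_from_le: "\<And>v. v \<in> pverts G \<Longrightarrow> (\<Sum>u\<in>pverts G. d v u) \<le> order * (order - 1) / 2"
    and pseudometric_sum_le: "(\<Sum>u\<in>pverts G. \<Sum>v\<in>pverts G. d u v) \<le> order * (order\<^sup>2 - 1) / 3"
proof -
  define Q where "Q S \<longleftrightarrow> (\<forall>u\<in>S. \<forall>v\<in>S. d u v \<le> real (card S) - 1) \<and>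
      (\<forall>v\<in>S. (\<Sum>u\<in>S. d v u) \<le> real (card S) * (real (card S) - 1) / 2) \<and>
      (\<Sum>u\<in>S. \<Sum>v\<in>S. d u v) \<le> real (card S) * ((real (card S))\<^sup>2 - 1) / 3" for S
  have "Q (pverts G)"
  proof (induction rule: grow_induct)
    case (single a)
    then show ?case by (simp add: Q_def refl)
  next
    case (grow S w x)
    define k where "k = real (card S)"
    have fin: "finite S" using grow.hyps(1) pair_finite_verts by (rule finite_subset)
    have card: "real (card (insert x S)) = k + 1" using fin grow by (simp add: k_def)
    have diam: "\<And>u v. u \<in> S \<Longrightarrow> v \<in> S \<Longrightarrow> d u v \<le> k - 1"
      and from_le: "\<And>v. v \<in> S \<Longrightarrow> (\<Sum>u\<in>S. d v u) \<le> k * (k - 1) / 2"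
      and total: "(\<Sum>u\<in>S. \<Sum>v\<in>S. d u v) \<le> k * (k\<^sup>2 - 1) / 3"
      using grow.IH by (auto simp: Q_def k_def)
    have inV: "u \<in> pverts G" if "u \<in> insert x S" for u using that grow by auto
    have dx: "d x u \<le> 1 + d w u" if "u \<in> S" for u
      using triangle[of x w u] arc[OF grow.hyps(5)] sym[of x w] grow that inV by auto
    have dx_le: "d x u \<le> k" if "u \<in> S" for u
      using dx[OF that] diam[OF grow.hyps(2) that] by simp
    have "(\<Sum>u\<in>S. d x u) \<le> (\<Sum>u\<in>S. 1 + d w u)" using dx by (rule sum_mono)
    also have "\<dots> \<le> k + k * (k - 1) / 2"
      using from_le[OF grow.hyps(2)] by (simp add: sum.distrib k_def)
    finally have x_sum: "(\<Sum>u\<in>S. d x u) \<le> k * (k + 1) / 2" by (simp add: field_simps)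
    have xx: "d x x = 0" and swap: "\<And>u. u \<in> S \<Longrightarrow> d u x = d x u"
      using refl sym inV by auto
    have "d u v \<le> k" if "u \<in> insert x S" "v \<in> insert x S" for u v
      using that dx_le diam[of u v] xx swap by (fastforce simp: k_def)
    moreover have "(\<Sum>u\<in>insert x S. d v u) \<le> (k + 1) * k / 2" if "v \<in> insert x S" for v
    proof (cases "v = x")
      case True
      then show ?thesis using x_sum xx fin grow by (simp add: mult.commute)
    next
      case False
      then have v: "v \<in> S" using that by simp
      have "(\<Sum>u\<in>insert x S. d v u) = d x v + (\<Sum>u\<in>S. d v u)"
        using fin grow swap[OF v] by simp
      also have "\<dots> \<le> k + k * (k - 1) / 2" using dx_le[OF v] from_le[OF v] by simp
      finally show ?thesis by (simp add: field_simps)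
    qed
    moreover have "(\<Sum>u\<in>insert x S. \<Sum>v\<in>insert x S. d u v) \<le> (k + 1) * ((k + 1)\<^sup>2 - 1) / 3"
    proof -
      have "(\<Sum>u\<in>insert x S. \<Sum>v\<in>insert x S. d u v)
          = 2 * (\<Sum>u\<in>S. d x u) + (\<Sum>u\<in>S. \<Sum>v\<in>S. d u v)"
        using fin grow xx swap by (simp add: sum.distrib)
      also have "\<dots> \<le> 2 * (k * (k + 1) / 2) + k * (k\<^sup>2 - 1) / 3"
        using x_sum total by linarith
      also have "\<dots> = (k + 1) * ((k + 1)\<^sup>2 - 1) / 3"
        by (simp add: field_simps power2_eq_square)
      finally show ?thesis .
    qed
    ultimately show ?case unfolding Q_def card by simp
  qed
  then show "\<And>v. v \<in> pverts G \<Longrightarrow> (\<Sum>u\<in>pverts G. d v u) \<le> order * (order - 1) / 2"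
    "(\<Sum>u\<in>pverts G. \<Sum>v\<in>pverts G. d u v) \<le> order * (order\<^sup>2 - 1) / 3"
    by (auto simp: Q_def)
qed

end

section \<open>Composite graphs\<close>

text \<open>
  A nonempty closed set meets some part, hence contains all of it and with it a bridge node; thus
  it contains the backbone, so all bridge nodes, and with them all parts.
\<close>

lemma cut_connected_graph_composite:
  assumes G: "\<And>i. i \<in> {1..n} \<Longrightarrow> cut_connected_graph (G i)"
    and l: "\<And>i. i \<in> {1..n} \<Longrightarrow> l i \<in> pverts (G i)"
    and B: "cut_connected_graph B" and verts_B: "pverts B = l ` {1..n}"
  shows "cut_connected_graph (composite_graph n G B)"
proof -
  let ?C = "composite_graph n G B"
  have V: "pverts ?C = (\<Union>i\<in>{1..n}. pverts (G i))"
    and E: "parcs ?C = (\<Union>i\<in>{1..n}. parcs (G i)) \<union> parcs B"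
    by (simp_all add: composite_graph_def)
  interpret B: cut_connected_graph B by fact
  have l_verts: "l ` {1..n} \<subseteq> pverts ?C" using l unfolding V by blast
  have pg: "pair_graph (G i)" if "i \<in> {1..n}" for i
    using G[OF that] by (simp add: cut_connected_graph_def)
  have wf: "pair_wf_digraph (G i)" and fin: "pair_fin_digraph (G i)"
    and sym: "sym (parcs (G i))" and loopfree: "pair_loopfree_digraph (G i)"
    if "i \<in> {1..n}" for i
  proof -
    interpret pair_graph "G i" using pg that by blast
    show "pair_wf_digraph (G i)" "pair_fin_digraph (G i)" "pair_loopfree_digraph (G i)"
      by unfold_locales
    show "sym (parcs (G i))" using arcs_symmetric by (auto intro: symI)
  qed
  have "sym (parcs ?C)"
    unfolding E using sym B.arc_commute by (intro sym_Un sym_UNION) (auto intro: symI)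
  moreover have "fst e \<in> pverts ?C \<and> snd e \<in> pverts ?C \<and> fst e \<noteq> snd e" if "e \<in> parcs ?C" for e
  proof (cases "e \<in> parcs B")
    case True
    then have "fst e \<in> l ` {1..n}" "snd e \<in> l ` {1..n}" "fst e \<noteq> snd e"
      using B.arc_fst_in_verts B.arc_snd_in_verts B.pair_no_loops verts_B by auto
    then show ?thesis using l_verts by blast
  next
    case False
    then obtain i where i: "i \<in> {1..n}" "e \<in> parcs (G i)" using \<open>e \<in> parcs ?C\<close> E by auto
    then show ?thesis
      using pair_wf_digraph.arc_fst_in_verts[OF wf] pair_wf_digraph.arc_snd_in_verts[OF wf]
        pair_loopfree_digraph.pair_no_loops[OF loopfree] unfolding V by blast
  qed
  moreover have "finite (pverts ?C)"
    unfolding V using pair_fin_digraph.pair_finite_verts[OF fin] by blast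
  moreover have "finite (parcs ?C)"
    unfolding E using pair_fin_digraph.pair_finite_arcs[OF fin] B.pair_finite_arcs by blast
  ultimately have "pair_graph ?C"
    by unfold_locales (auto simp: symmetric_def)
  moreover have "pverts ?C \<noteq> {}"
    using B.nonempty l_verts unfolding verts_B by blast
  moreover have "S = pverts ?C"
    if S: "S \<subseteq> pverts ?C" "S \<noteq> {}"
      and closed: "\<And>u v. (u, v) \<in> parcs ?C \<Longrightarrow> u \<in> S \<Longrightarrow> v \<in> S" for S
  proof -
    have part: "pverts (G i) \<subseteq> S" if "i \<in> {1..n}" "S \<inter> pverts (G i) \<noteq> {}" for i
    proof -
      have "S \<inter> pverts (G i) = pverts (G i)"
      proof (rule cut_connected_graph.closed_eq_verts[OF G[OF that(1)]])
        fix u v assume arc: "(u, v) \<in> parcs (G i)" and u: "u \<in> S \<inter> pverts (G i)"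
        have "(u, v) \<in> parcs ?C" using arc that unfolding E by blast
        moreover have "v \<in> pverts (G i)"
          using pair_wf_digraph.arc_snd_in_verts[OF wf[OF that(1)] arc] by simp
        ultimately show "v \<in> S \<inter> pverts (G i)" using closed u by blast
      qed (use that in auto)
      then show ?thesis by blast
    qed
    obtain i where i: "i \<in> {1..n}" "S \<inter> pverts (G i) \<noteq> {}" using S unfolding V by blast
    then have "l i \<in> S" using part l by blast
    have "S \<inter> pverts B = pverts B"
    proof (rule B.closed_eq_verts)
      fix u v assume arc: "(u, v) \<in> parcs B" and u: "u \<in> S \<inter> pverts B"
      have "(u, v) \<in> parcs ?C" using arc unfolding E by blast
      moreover have "v \<in> pverts B" using B.arc_snd_in_verts[OF arc] by simp
      ultimately show "v \<in> S \<inter> pverts B" using closed u by blast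
    qed (use \<open>l i \<in> S\<close> i verts_B in auto)
    then have "l j \<in> S" if "j \<in> {1..n}" for j using that verts_B by blast
    then have "pverts (G j) \<subseteq> S" if "j \<in> {1..n}" for j using that part l by blast
    then show ?thesis using S unfolding V by blast
  qed
  ultimately show ?thesis
    by (simp add: cut_connected_graph_def cut_connected_graph_axioms_def)
qed

theorem corollary4:
  fixes G :: "nat \<Rightarrow> 'a pair_pre_digraph"
    and B :: "'a pair_pre_digraph"
    and l :: "nat \<Rightarrow> 'a"
    and n m N :: nat
  assumes "\<And>i. i \<in> {1..n} \<Longrightarrow> pair_graph (G i)"
    and "\<And>i. i \<in> {1..n} \<Longrightarrow> Digraph_Component.connected (with_proj (G i))"
    and "disjoint_family_on (\<lambda>i. pverts (G i)) {1..n}"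
    and "\<And>i. i \<in> {1..n} \<Longrightarrow> card (pverts (G i)) = m"
    and "\<And>i. i \<in> {1..n} \<Longrightarrow> l i \<in> pverts (G i)"
    and "pair_graph B"
    and "Digraph_Component.connected (with_proj B)"
    and "pverts B = l ` {1..n}"
    and "N = n * m"
  shows "network_coherence (composite_graph n G B)
    \<le> real n * real m * ((real m)\<^sup>2 - 1) / (12 * real N)
      + real n * (real m)\<^sup>2 * ((real n)\<^sup>2 - 1) / (12 * real N)
      + real n * (real m)\<^sup>2 * (real m - 1) * (real n - 1) / (4 * real N)"
proof -
  let ?I = "{1..n}" and ?V = "\<lambda>i. pverts (G i)"
  have G: "cut_connected_graph (G i)" if "i \<in> ?I" for i
    using assms(1,2) that by (intro cut_connected_graph_if_connected) auto
  interpret B: cut_connected_graph B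
    using assms(6,7) by (rule cut_connected_graph_if_connected)
  interpret C: cut_connected_graph "composite_graph n G B"
    using G assms(5) B.cut_connected_graph_axioms assms(8) by (rule cut_connected_graph_composite)
  let ?r = C.resistance
  have V: "pverts (composite_graph n G B) = (\<Union>i\<in>?I. ?V i)"
    and E: "parcs (composite_graph n G B) = (\<Union>i\<in>?I. parcs (G i)) \<union> parcs B"
    by (simp_all add: composite_graph_def)
  have fin: "finite (?V i)" if "i \<in> ?I" for i
    using C.pair_finite_verts that unfolding V by simp
  have disj: "\<forall>i\<in>?I. \<forall>j\<in>?I. i \<noteq> j \<longrightarrow> ?V i \<inter> ?V j = {}"
    using assms(3) by (simp add: disjoint_family_on_def)
  have inj: "inj_on l ?I"
    using disj assms(5) by (intro inj_onI) (metis disjoint_iff)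
  have inC: "u \<in> pverts (composite_graph n G B)" if "i \<in> ?I" "u \<in> ?V i" for i u
    using that unfolding V by blast
  have l_inC: "l i \<in> pverts (composite_graph n G B)" if "i \<in> ?I" for i
    using inC assms(5) that by blast
  have from_le: "(\<Sum>u\<in>?V i. ?r (l i) u) \<le> real m * (real m - 1) / 2"
    and within_le: "(\<Sum>u\<in>?V i. \<Sum>v\<in>?V i. ?r u v) \<le> real m * ((real m)\<^sup>2 - 1) / 3" if i: "i \<in> ?I" for i
  proof -
    interpret Gi: cut_connected_graph "G i" using G i by blast
    have arc: "?r u v \<le> 1" if "(u, v) \<in> parcs (G i)" for u v
      using that i E by (intro C.resistance_arc_le_1) auto
    show "(\<Sum>u\<in>?V i. ?r (l i) u) \<le> real m * (real m - 1) / 2"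
      using Gi.pseudometric_sum_from_le[of ?r "l i"] arc C.resistance_refl C.resistance_sym
        C.resistance_triangle inC[OF i] assms(4,5) i by simp
    show "(\<Sum>u\<in>?V i. \<Sum>v\<in>?V i. ?r u v) \<le> real m * ((real m)\<^sup>2 - 1) / 3"
      using Gi.pseudometric_sum_le[of ?r] arc C.resistance_refl C.resistance_sym
        C.resistance_triangle inC[OF i] assms(4) i by simp
  qed
  have backbone_le: "(\<Sum>i\<in>?I. \<Sum>j\<in>?I. ?r (l i) (l j)) \<le> real n * ((real n)\<^sup>2 - 1) / 3"
  proof -
    have "(\<Sum>u\<in>pverts B. \<Sum>v\<in>pverts B. ?r u v) \<le> B.order * (B.order\<^sup>2 - 1) / 3"
    proof (rule B.pseudometric_sum_le)
      show "?r u v \<le> 1" if "(u, v) \<in> parcs B" for u v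
        using that E by (intro C.resistance_arc_le_1) auto
      show "?r u w \<le> ?r u v + ?r v w" if "u \<in> pverts B" "v \<in> pverts B" "w \<in> pverts B" for u v w
        using that l_inC assms(8) by (intro C.resistance_triangle) auto
    qed (rule C.resistance_refl C.resistance_sym)+
    then show ?thesis using inj by (simp add: assms(8) sum.reindex card_image)
  qed
  \<comment> \<open>On a diagonal block the backbone term vanishes, so one formula serves all blocks.\<close>
  have block_le: "(\<Sum>u\<in>?V i. \<Sum>v\<in>?V j. ?r u v)
      \<le> (if i = j then real m * ((real m)\<^sup>2 - 1) / 3 else (real m)\<^sup>2 * (real m - 1))
        + (real m)\<^sup>2 * ?r (l i) (l j)" if ij: "i \<in> ?I" "j \<in> ?I" for i j
  proof (cases "i = j")
    case True
    then show ?thesis using within_le ij by (simp add: C.resistance_refl)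
  next
    case False
    have "?r u v \<le> ?r (l i) u + ?r (l i) (l j) + ?r (l j) v" if "u \<in> ?V i" "v \<in> ?V j" for u v
      using C.resistance_triangle[of u "l i" v] C.resistance_triangle[of "l i" "l j" v]
        C.resistance_sym[of u "l i"] inC[OF ij(1) that(1)] inC[OF ij(2) that(2)] l_inC ij by simp
    then have "(\<Sum>u\<in>?V i. \<Sum>v\<in>?V j. ?r u v)
        \<le> (\<Sum>u\<in>?V i. \<Sum>v\<in>?V j. ?r (l i) u + ?r (l i) (l j) + ?r (l j) v)"
      by (intro sum_mono) auto
    also have "\<dots> = real m * (\<Sum>u\<in>?V i. ?r (l i) u) + (real m)\<^sup>2 * ?r (l i) (l j)
        + real m * (\<Sum>v\<in>?V j. ?r (l j) v)"
      using assms(4) ij by (simp add: sum.distrib power2_eq_square distrib_left flip: sum_distrib_left)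
    also have "\<dots> \<le> real m * (real m * (real m - 1) / 2) + (real m)\<^sup>2 * ?r (l i) (l j)
        + real m * (real m * (real m - 1) / 2)"
      using from_le ij by (intro add_mono mult_left_mono) auto
    also have "\<dots> = (real m)\<^sup>2 * (real m - 1) + (real m)\<^sup>2 * ?r (l i) (l j)"
      by (simp add: field_simps power2_eq_square)
    finally show ?thesis using False by simp
  qed
  have count: "(\<Sum>i\<in>?I. \<Sum>j\<in>?I. if i = j then a else b) = real n * (a + (real n - 1) * b)"
    for a b :: real
  proof -
    have "(\<Sum>j\<in>?I. if i = j then a else b) = a + (real n - 1) * b" if "i \<in> ?I" for i
    proof -
      have "(\<Sum>j\<in>?I. if i = j then a else b) = (\<Sum>j\<in>?I. b + (if i = j then a - b else 0))"
        by (intro sum.cong) auto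
      also have "\<dots> = real n * b + (a - b)" using that by (simp add: sum.distrib)
      finally show ?thesis by (simp add: algebra_simps)
    qed
    then show ?thesis by simp
  qed
  let ?T = "\<Sum>u\<in>pverts (composite_graph n G B). \<Sum>v\<in>pverts (composite_graph n G B). ?r u v"
  have UN: "sum f (\<Union>i\<in>?I. ?V i) = (\<Sum>i\<in>?I. sum f (?V i))" for f :: "'a \<Rightarrow> real"
    using fin disj by (intro sum.UNION_disjoint) auto
  have "?T = (\<Sum>i\<in>?I. \<Sum>u\<in>?V i. \<Sum>j\<in>?I. \<Sum>v\<in>?V j. ?r u v)"
    unfolding V UN ..
  also have "\<dots> = (\<Sum>i\<in>?I. \<Sum>j\<in>?I. \<Sum>u\<in>?V i. \<Sum>v\<in>?V j. ?r u v)"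
    by (intro sum.cong refl sum.swap)
  also have "\<dots> \<le> (\<Sum>i\<in>?I. \<Sum>j\<in>?I.
      (if i = j then real m * ((real m)\<^sup>2 - 1) / 3 else (real m)\<^sup>2 * (real m - 1))
        + (real m)\<^sup>2 * ?r (l i) (l j))"
    by (intro sum_mono block_le)
  also have "\<dots> = real n * (real m * ((real m)\<^sup>2 - 1) / 3 + (real n - 1) * ((real m)\<^sup>2 * (real m - 1)))
      + (real m)\<^sup>2 * (\<Sum>i\<in>?I. \<Sum>j\<in>?I. ?r (l i) (l j))"
    by (simp only: sum.distrib count sum_distrib_left)
  also have "\<dots> \<le> real n * (real m * ((real m)\<^sup>2 - 1) / 3 + (real n - 1) * ((real m)\<^sup>2 * (real m - 1)))
      + (real m)\<^sup>2 * (real n * ((real n)\<^sup>2 - 1) / 3)"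
    using backbone_le by (intro add_left_mono mult_left_mono) auto
  finally have T: "?T \<le> \<dots>" .
  have order: "C.order = real N"
    unfolding V assms(9) using fin disj assms(4) by (subst card_UN_disjoint) auto
  have "network_coherence (composite_graph n G B) = ?T / (4 * real N)"
    using C.network_coherence_eq_resistance_sum order by simp
  also have "\<dots> \<le> (real n * (real m * ((real m)\<^sup>2 - 1) / 3 + (real n - 1) * ((real m)\<^sup>2 * (real m - 1)))
      + (real m)\<^sup>2 * (real n * ((real n)\<^sup>2 - 1) / 3)) / (4 * real N)"
    using T by (intro divide_right_mono) auto
  also have "\<dots> = real n * real m * ((real m)\<^sup>2 - 1) / (12 * real N)
      + real n * (real m)\<^sup>2 * ((real n)\<^sup>2 - 1) / (12 * real N)
      + real n * (real m)\<^sup>2 * (real m - 1) * (real n - 1) / (4 * real N)"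
    using C.order_pos order by (simp add: field_simps)
  finally show ?thesis .
qed

end
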